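(* Let $X$ be a nonempty set and $Y$ a nonempty subset of $X$. Then $\operatorname{ureg}(\overline{\Omega}(X,Y))=\operatorname{ureg}(\overline{S}(X,Y))$.
   Context: $T(X)$ is the semigroup of all maps $X\to X$ under composition; maps are written on the right and composed from left to right, so $x(fg)=(xf)g$, and $Yf=\{yf\colon y\in Y\}$. Let $\overline{\Omega}(X,Y)=\{f\in T(X)\colon Yf=Y\}$, a subsemigroup of $T(X)$. If $Yf\subseteq Y$, then $f_{\upharpoonright Y}\colon Y\to Y$ denotes the map that agrees with $f$ on $Y$. Let $S(Y)$ be the symmetric group on $Y$ (all bijections $Y\to Y$), and let $\overline{S}(X,Y)=\{f\in T(X)\colon Yf\subseteq Y \text{ and } f_{\upharpoonright Y}\in S(Y)\}$, a subsemigroup of $\overline{\Omega}(X,Y)$. Both semigroups contain the identity map. For a semigroup $S$ with identity, $U(S)$ is the set of all units of $S$; an element $a\in S$ is unit-regular if $aba=a$ for some $b\in U(S)$, and $\operatorname{ureg}(S)$ is the set of all unit-regular elements of $S$. *)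

theory Defs
  imports "HOL-Algebra.Bij"
begin

text \<open>
  Maps \<open>X \<rightarrow> X\<close> are represented by extensional functions, as in
  \<^theory>\<open>HOL-Algebra.Bij\<close>. Maps are written on the right and composed from left to
  right, so the product of \<open>f\<close> and \<open>g\<close> applies \<open>f\<close> first.
\<close>

definition full_transf :: "'a set \<Rightarrow> ('a \<Rightarrow> 'a) monoid" where
  "full_transf X =
    \<lparr>carrier = X \<rightarrow>\<^sub>E X, mult = (\<lambda>f g. compose X g f), one = (\<lambda>x\<in>X. x)\<rparr>"

definition Omega_bar :: "'a set \<Rightarrow> 'a set \<Rightarrow> ('a \<Rightarrow> 'a) monoid" where
  "Omega_bar X Y = (full_transf X)\<lparr>carrier := {f \<in> carrier (full_transf X). f ` Y = Y}\<rparr>"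

text \<open>The symmetric group \<open>S(Y)\<close> has underlying set \<^term>\<open>Bij Y\<close>.\<close>

definition S_bar :: "'a set \<Rightarrow> 'a set \<Rightarrow> ('a \<Rightarrow> 'a) monoid" where
  "S_bar X Y = (full_transf X)\<lparr>carrier :=
    {f \<in> carrier (full_transf X). f ` Y \<subseteq> Y \<and> restrict f Y \<in> Bij Y}\<rparr>"

definition ureg :: "('a, 'b) monoid_scheme \<Rightarrow> 'a set" where
  "ureg M = {a \<in> carrier M. \<exists>b \<in> Units M. a \<otimes>\<^bsub>M\<^esub> b \<otimes>\<^bsub>M\<^esub> a = a}"

lemma monoid_full_transf: "monoid (full_transf X)"
  by (rule monoidI)
    (auto simp: full_transf_def compose_def restrict_def PiE_iff extensional_def fun_eq_iff)

lemma monoid_Omega_bar: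
  assumes "Y \<subseteq> X"
  shows "monoid (Omega_bar X Y)"
proof (rule monoidI)
  fix f g
  assume "f \<in> carrier (Omega_bar X Y)" "g \<in> carrier (Omega_bar X Y)"
  then have f: "f \<in> X \<rightarrow>\<^sub>E X" "f ` Y = Y" and g: "g \<in> X \<rightarrow>\<^sub>E X" "g ` Y = Y"
    by (auto simp: Omega_bar_def full_transf_def)
  have "compose X g f ` Y = g ` f ` Y"
    using assms by (force simp: compose_def)
  with f g show "f \<otimes>\<^bsub>Omega_bar X Y\<^esub> g \<in> carrier (Omega_bar X Y)"
    by (auto simp: Omega_bar_def full_transf_def compose_def PiE_iff)
next
  show "\<one>\<^bsub>Omega_bar X Y\<^esub> \<in> carrier (Omega_bar X Y)"
    using assms by (force simp: Omega_bar_def full_transf_def)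
qed (auto simp: Omega_bar_def full_transf_def compose_def restrict_def PiE_iff
      extensional_def fun_eq_iff)

lemma carrier_S_bar:
  "carrier (S_bar X Y) = {f \<in> carrier (Omega_bar X Y). inj_on f Y}"
  by (auto simp: S_bar_def Omega_bar_def Bij_def bij_betw_def inj_on_def)

lemma monoid_S_bar:
  assumes "Y \<subseteq> X"
  shows "monoid (S_bar X Y)"
proof -
  interpret Om: monoid "Omega_bar X Y"
    using assms by (rule monoid_Omega_bar)
  have eq: "f \<otimes>\<^bsub>S_bar X Y\<^esub> g = f \<otimes>\<^bsub>Omega_bar X Y\<^esub> g"
    "\<one>\<^bsub>S_bar X Y\<^esub> = \<one>\<^bsub>Omega_bar X Y\<^esub>" for f g
    by (simp_all add: S_bar_def Omega_bar_def)
  show ?thesis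
  proof (rule monoidI)
    fix f g
    assume fg: "f \<in> carrier (S_bar X Y)" "g \<in> carrier (S_bar X Y)"
    then have "inj_on f Y" "inj_on g Y" "f ` Y = Y"
      by (auto simp: carrier_S_bar Omega_bar_def)
    then have "inj_on (\<lambda>x. g (f x)) Y"
      using comp_inj_on[of f Y g] by (simp add: comp_def)
    then have "inj_on (compose X g f) Y"
      using assms by (subst inj_on_cong[where g = "\<lambda>x. g (f x)"]) (auto simp: compose_def)
    with fg show "f \<otimes>\<^bsub>S_bar X Y\<^esub> g \<in> carrier (S_bar X Y)"
      unfolding eq carrier_S_bar by (simp add: Omega_bar_def full_transf_def[of X])
        (use Om.m_closed[of f g] in \<open>auto simp: carrier_S_bar Omega_bar_def full_transf_def\<close>)
  next
    show "\<one>\<^bsub>S_bar X Y\<^esub> \<in> carrier (S_bar X Y)"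
      unfolding eq carrier_S_bar using assms Om.one_closed
      by (auto simp: Omega_bar_def full_transf_def inj_on_def)
  qed (auto simp: eq carrier_S_bar Om.m_assoc)
qed

end

theory Submission
  imports Defs
begin

text \<open>
  Elements of \<^term>\<open>Omega_bar X Y\<close> map \<open>Y\<close> onto \<open>Y\<close>, and \<^term>\<open>S_bar X Y\<close> consists of those
  that are moreover injective on \<open>Y\<close> (\<open>carrier_S_bar\<close>). There are two reasons why the unit-regular
  elements agree. A unit is injective on all of \<open>X\<close>, hence on \<open>Y\<close>, and so is its inverse;
  the two monoids therefore have the same units (\<open>Units_S_bar_eq\<close>). And whenever \<open>aba = a\<close> in
  \<^term>\<open>Omega_bar X Y\<close>, the product \<open>ab\<close> maps \<open>Y\<close> onto \<open>Y\<close> and is idempotent, hence is the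
  identity on \<open>Y\<close>; so \<open>a\<close> is injective on \<open>Y\<close> (\<open>regular_Omega_bar_in_S_bar\<close>).
\<close>

lemma mult_S_bar: "f \<otimes>\<^bsub>S_bar X Y\<^esub> g = f \<otimes>\<^bsub>Omega_bar X Y\<^esub> g"
  and one_S_bar: "\<one>\<^bsub>S_bar X Y\<^esub> = \<one>\<^bsub>Omega_bar X Y\<^esub>"
  by (simp_all add: S_bar_def Omega_bar_def)

lemma mult_Omega_bar_apply:
  "x \<in> X \<Longrightarrow> (f \<otimes>\<^bsub>Omega_bar X Y\<^esub> g) x = g (f x)"
  by (simp add: Omega_bar_def full_transf_def compose_def)

lemma one_Omega_bar_apply: "x \<in> X \<Longrightarrow> \<one>\<^bsub>Omega_bar X Y\<^esub> x = x"
  by (simp add: Omega_bar_def full_transf_def)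

lemma Omega_bar_image: "f \<in> carrier (Omega_bar X Y) \<Longrightarrow> f ` Y = Y"
  by (simp add: Omega_bar_def)

lemma right_invertible_Omega_bar_in_S_bar:
  assumes "Y \<subseteq> X" and f: "f \<in> carrier (Omega_bar X Y)"
    and inv: "f \<otimes>\<^bsub>Omega_bar X Y\<^esub> g = \<one>\<^bsub>Omega_bar X Y\<^esub>"
  shows "f \<in> carrier (S_bar X Y)"
proof -
  have "g (f y) = y" if "y \<in> Y" for y
    using fun_cong[OF inv, of y] that \<open>Y \<subseteq> X\<close>
    by (simp add: mult_Omega_bar_apply one_Omega_bar_apply subset_iff)
  then have "inj_on f Y"
    by (rule inj_on_inverseI)
  with f show ?thesis
    by (simp add: carrier_S_bar)
qed

lemma Units_S_bar_eq:
  assumes "Y \<subseteq> X"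
  shows "Units (S_bar X Y) = Units (Omega_bar X Y)"
proof
  show "Units (S_bar X Y) \<subseteq> Units (Omega_bar X Y)"
    by (auto simp: Units_def mult_S_bar one_S_bar carrier_S_bar)
  show "Units (Omega_bar X Y) \<subseteq> Units (S_bar X Y)"
    using right_invertible_Omega_bar_in_S_bar[OF assms]
    unfolding Units_def mult_S_bar one_S_bar by blast
qed

text \<open>
  Surjectivity of \<open>ab\<close> on \<open>Y\<close> is what turns the equation \<open>aba = a\<close> into injectivity:
  every point of \<open>Y\<close> has the form \<open>z(ab)\<close>, and \<open>ab\<close> fixes such points because
  \<open>(ab)(ab) = (aba)b = ab\<close>.
\<close>

lemma regular_Omega_bar_in_S_bar:
  assumes "Y \<subseteq> X"
    and a: "a \<in> carrier (Omega_bar X Y)" and b: "b \<in> carrier (Omega_bar X Y)"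
    and reg: "a \<otimes>\<^bsub>Omega_bar X Y\<^esub> b \<otimes>\<^bsub>Omega_bar X Y\<^esub> a = a"
  shows "a \<in> carrier (S_bar X Y)"
proof -
  have "b (a y) = y" if "y \<in> Y" for y
  proof -
    have "b ` a ` Y = Y"
      using a b by (simp add: Omega_bar_image)
    with that obtain z where z: "z \<in> Y" "y = b (a z)"
      by blast
    with fun_cong[OF reg, of z] \<open>Y \<subseteq> X\<close> have "a y = a z"
      by (simp add: mult_Omega_bar_apply subset_iff)
    with z show ?thesis
      by simp
  qed
  then have "inj_on a Y"
    by (rule inj_on_inverseI)
  with a show ?thesis
    by (simp add: carrier_S_bar)
qed

theorem theorem3p5:
  fixes X Y :: "'a set"
  assumes "X \<noteq> {}" and "Y \<noteq> {}" and "Y \<subseteq> X"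
  shows "ureg (Omega_bar X Y) = ureg (S_bar X Y)"
proof
  show "ureg (Omega_bar X Y) \<subseteq> ureg (S_bar X Y)"
    using regular_Omega_bar_in_S_bar[OF \<open>Y \<subseteq> X\<close>]
    unfolding ureg_def Units_S_bar_eq[OF \<open>Y \<subseteq> X\<close>] mult_S_bar by (auto simp: Units_def)
  show "ureg (S_bar X Y) \<subseteq> ureg (Omega_bar X Y)"
    unfolding ureg_def Units_S_bar_eq[OF \<open>Y \<subseteq> X\<close>] mult_S_bar by (auto simp: carrier_S_bar)
qed

end
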